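(* Let $\mathcal{A}$ be a unital associative algebra over a field of characteristic $0$, let $A\in\operatorname{Mat}(\mathcal{A},n,n)$ and let $I$ be the identity matrix in $\operatorname{Mat}(\mathcal{A},n,n)$ (diagonal entries $1_{\mathcal{A}}$, off-diagonal entries $0$). Then $\mathsf{sdet}(A+I) = \sum_{S\subseteq[n]} \mathsf{sdet}(A_S)$, where $A_S$ is the principal submatrix of $A$ with rows and columns indexed by $S$ (with the convention that the term for $S=\emptyset$ is $1_{\mathcal{A}}$).
   Context: For a $k\times k$ matrix $M=(m_{ij})$ with entries in an associative algebra $\mathcal{A}$ over a field of characteristic $0$, the symmetrized determinant is $\mathsf{sdet}\, M = \frac{1}{k!}\sum_{(\sigma,\tau)\in \mathsf{Sym}_k\times\mathsf{Sym}_k} (\operatorname{sgn}\sigma)(\operatorname{sgn}\tau)\, m_{\sigma(1)\tau(1)} \cdots m_{\sigma(k)\tau(k)}$, products taken in the indicated order. $\operatorname{Mat}(\mathcal{A},n,n)$ denotes the $n\times n$ matrices over $\mathcal{A}$; $1_{\mathcal{A}}$ is the unit of $\mathcal{A}$. *)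

theory Defs
  imports "Jordan_Normal_Form.DL_Submatrix" "HOL-Combinatorics.Permutations"
begin

text \<open>The sort \<open>{ring, monoid_mult}\<close> is an associative unital ring; unlike \<open>ring_1\<close> it does
  not exclude the zero algebra, where \<open>0 = 1\<close>.\<close>

locale unital_algebra = vector_space scale
  for scale :: "'k::field_char_0 \<Rightarrow> 'a::{ring, monoid_mult} \<Rightarrow> 'a" +
  assumes scale_mult_left: "scale c x * y = scale c (x * y)"
    and mult_scale_right: "x * scale c y = scale c (x * y)"

text \<open>Indices run over \<open>{0..<k}\<close> instead of \<open>{1..k}\<close>. The matrix is meant to be square, with
  \<open>k = dim_row M\<close>; \<open>prod_list\<close> multiplies the factors in the order \<open>0, 1, \<dots>, k - 1\<close>.\<close>

definition sdet ::
  "('k::field_char_0 \<Rightarrow> 'a::{ring, monoid_mult} \<Rightarrow> 'a) \<Rightarrow> 'a mat \<Rightarrow> 'a" where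
  "sdet scale M = (let k = dim_row M in
     scale (1 / fact k)
       (\<Sum>(\<sigma>, \<tau>) \<in> {\<sigma>. \<sigma> permutes {0..<k}} \<times> {\<tau>. \<tau> permutes {0..<k}}.
          scale (of_int (sign \<sigma>) * of_int (sign \<tau>))
            (prod_list (map (\<lambda>i. M $$ (\<sigma> i, \<tau> i)) [0..<k]))))"

lemma sdet_dim_0:
  assumes "unital_algebra scale" and "dim_row M = 0"
  shows "sdet scale M = 1"
proof -
  interpret unital_algebra scale by fact
  show ?thesis using assms(2) by (simp add: sdet_def)
qed

lemma sdet_submatrix_empty:
  assumes "unital_algebra scale"
  shows "sdet scale (submatrix A {} {}) = 1"
  by (rule sdet_dim_0[OF assms]) (simp add: dim_submatrix)

end

theory Submission
  imports Defs "HOL-Combinatorics.Multiset_Permutations"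
begin

text \<open>Substituting \<open>\<tau> = \<pi> \<circ> \<sigma>\<close> in the definition and recording \<open>\<sigma>\<close> as the list
  \<open>xs = [\<sigma> 0, \<dots>, \<sigma> (k - 1)]\<close> turns \<open>k! sdet M\<close> into the sum, over all orderings \<open>xs\<close> of the
  index set, of the ordinary Leibniz sum with every product taken in the order \<open>xs\<close>. For a fixed
  order, the Leibniz sum of \<open>A + I\<close> expands over subsets \<open>S\<close> as in the commutative case, and the
  factors that survive appear in the order that \<open>xs\<close> induces on \<open>S\<close>. By symmetry every order of
  \<open>S\<close> is induced equally often, that is \<open>n! / |S|!\<close> times.\<close>

text \<open>The index type is arbitrary and the order of multiplication is a list, so a list
  enumerating \<open>S\<close> stands for the principal submatrix on \<open>S\<close> without
  renumbering its rows. Meant for distinct lists.\<close>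

definition ordered_det ::
  "('k::field_char_0 \<Rightarrow> 'a::{ring, monoid_mult} \<Rightarrow> 'a) \<Rightarrow> ('i \<Rightarrow> 'i \<Rightarrow> 'a) \<Rightarrow> 'i list \<Rightarrow> 'a" where
  "ordered_det scale a xs = (\<Sum>\<pi> | \<pi> permutes set xs.
     scale (of_int (sign \<pi>)) (prod_list (map (\<lambda>x. a x (\<pi> x)) xs)))"

text \<open>A permutation is the identity outside \<open>set ys\<close>, so its values on
  \<open>ys\<close> determine it. Surjectivity follows by counting: both sides have
  \<open>fact (card (set ys))\<close> elements.\<close>

lemma bij_betw_map_permutes_permutations_of_set:
  assumes "distinct ys"
  shows "bij_betw (\<lambda>\<sigma>. map \<sigma> ys) {\<sigma>. \<sigma> permutes set ys} (permutations_of_set (set ys))"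
  unfolding bij_betw_def
proof (intro conjI)
  let ?f = "\<lambda>\<sigma>. map \<sigma> ys" and ?P = "{\<sigma>. \<sigma> permutes set ys}"
  show inj: "inj_on ?f ?P"
  proof (rule inj_onI)
    fix \<sigma> \<tau> assume "\<sigma> \<in> ?P" "\<tau> \<in> ?P" "map \<sigma> ys = map \<tau> ys"
    then show "\<sigma> = \<tau>"
      by (intro ext) (metis map_eq_conv mem_Collect_eq permutes_not_in)
  qed
  show "?f ` ?P = permutations_of_set (set ys)"
  proof (rule card_subset_eq)
    show "?f ` ?P \<subseteq> permutations_of_set (set ys)"
      using assms by (auto intro!: permutations_of_setI
          simp: permutes_image permutes_inj_on distinct_map permutes_in_image)
    show "card (?f ` ?P) = card (permutations_of_set (set ys))"
      by (simp add: card_image[OF inj] card_permutations[OF refl])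
  qed simp
qed

lemma bij_betw_map_permutation:
  assumes "bij_betw f A B"
  shows "bij_betw (map_permutation A f) {\<pi>. \<pi> permutes A} {\<pi>. \<pi> permutes B}"
  using bij_betw_permutations[OF assms] assms
  by (simp add: map_permutation_def[abs_def] restrict_id_def[abs_def] bij_betw_def)

text \<open>\<open>pick S i\<close> is the element of \<open>S\<close> with exactly \<open>i\<close>
  smaller ones, so it is strictly increasing in \<open>i\<close> and the cardinalities force
  surjectivity. This is the numbering that \<open>submatrix\<close> uses.\<close>

lemma bij_betw_pick:
  assumes "finite S"
  shows "bij_betw (pick S) {0..<card S} S"
  unfolding bij_betw_def
proof (intro conjI)
  show inj: "inj_on (pick S) {0..<card S}"
    by (rule linorder_inj_onI) (use pick_mono_le in \<open>fastforce+\<close>)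
  show "pick S ` {0..<card S} = S"
    by (rule card_subset_eq) (auto simp: assms card_image[OF inj] pick_in_set_le)
qed

text \<open>Distributivity: \<open>S\<close> collects the elements at which \<open>f x\<close> is
  chosen. The other factors are 0 or 1, so they leave the order of the chosen ones intact and only
  decide whether the term survives.\<close>

lemma prod_list_add_indicator:
  fixes f :: "'i \<Rightarrow> 'a::{ring, monoid_mult}"
  assumes "distinct xs"
  shows "prod_list (map (\<lambda>x. f x + (if P x then 1 else 0)) xs) =
    (\<Sum>S\<in>Pow (set xs). if \<forall>x\<in>set xs - S. P x then prod_list (map f (filter (\<lambda>x. x \<in> S) xs)) else 0)"
  using assms
proof (induction xs)
  case Nil
  then show ?case by simp
next
  case (Cons x xs)
  let ?g = "\<lambda>ys S. if \<forall>x\<in>set ys - S. P x then prod_list (map f (filter (\<lambda>x. x \<in> S) ys)) else 0"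
  have x: "x \<notin> set xs" using Cons.prems by simp
  have 1: "?g (x # xs) S = (if P x then 1 else 0) * ?g xs S" if "S \<in> Pow (set xs)" for S
    using that x by auto
  have 2: "?g (x # xs) (insert x S) = f x * ?g xs S" if "S \<in> Pow (set xs)" for S
  proof -
    have "filter (\<lambda>y. y \<in> insert x S) xs = filter (\<lambda>y. y \<in> S) xs"
      using x by (intro filter_cong) auto
    moreover have "set (x # xs) - insert x S = set xs - S" using x by auto
    ultimately show ?thesis by simp
  qed
  \<comment> \<open>Subsets are split by whether they contain the head \<open>x\<close>. Those
    without it contribute the indicator, those with it the left factor \<open>f x\<close>.\<close>
  have "sum (?g (x # xs)) (Pow (set (x # xs))) =
      sum (?g (x # xs)) (Pow (set xs)) + sum (?g (x # xs)) (insert x ` Pow (set xs))"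
    unfolding list.set Pow_insert using x by (intro sum.union_disjoint) auto
  also have "sum (?g (x # xs)) (insert x ` Pow (set xs)) =
      (\<Sum>S\<in>Pow (set xs). ?g (x # xs) (insert x S))"
    using x by (intro sum.reindex_cong[where l = "insert x"]) (auto intro!: inj_onI)
  also have "sum (?g (x # xs)) (Pow (set xs)) + \<dots> =
      (if P x then 1 else 0) * sum (?g xs) (Pow (set xs)) + f x * sum (?g xs) (Pow (set xs))"
    unfolding sum_distrib_left using 1 2 by (intro arg_cong2[where f = plus] sum.cong) blast+
  finally show ?case using Cons by (simp add: distrib_right add.commute)
qed

text \<open>The symmetry argument as a double count, which avoids computing how many orderings of
  \<open>N\<close> induce a given ordering of \<open>S\<close>. Relabelling by \<rho> permutes the
  orderings of \<open>N\<close>, so it may be inserted without changing the inner sum; for fixed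
  \<open>xs\<close>, letting \<rho> vary then runs through every ordering of \<open>S\<close>
  once.\<close>

lemma sum_permutations_of_set_filter:
  assumes "finite N" "S \<subseteq> N"
  shows "(\<Sum>\<rho> | \<rho> permutes S. \<Sum>xs\<in>permutations_of_set N. g (filter (\<lambda>x. x \<in> S) xs)) =
    (\<Sum>xs\<in>permutations_of_set N. \<Sum>ys\<in>permutations_of_set S. g ys)"
proof -
  let ?F = "filter (\<lambda>x. x \<in> S)"
  have "(\<Sum>xs\<in>permutations_of_set N. g (?F xs)) =
      (\<Sum>xs\<in>permutations_of_set N. g (map \<rho> (?F xs)))" if \<rho>: "\<rho> permutes S" for \<rho>
  proof -
    have N: "\<rho> permutes N" using \<rho> assms(2) by (rule permutes_subset)
    have "(\<Sum>xs\<in>permutations_of_set N. g (?F xs)) =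
        (\<Sum>xs\<in>map \<rho> ` permutations_of_set N. g (?F xs))"
      by (simp add: permutations_of_set_image_permutes[OF N])
    also have "\<dots> = (\<Sum>xs\<in>permutations_of_set N. g (?F (map \<rho> xs)))"
      using permutes_inj[OF N] by (subst sum.reindex) (auto intro: inj_on_subset)
    \<comment> \<open>Since \<rho> maps \<open>S\<close> onto itself and its complement to itself,
      filtering by \<open>S\<close> commutes with relabelling.\<close>
    also have "\<dots> = (\<Sum>xs\<in>permutations_of_set N. g (map \<rho> (?F xs)))"
      by (simp add: filter_map o_def permutes_in_image[OF \<rho>])
    finally show ?thesis .
  qed
  then have "(\<Sum>\<rho> | \<rho> permutes S. \<Sum>xs\<in>permutations_of_set N. g (?F xs)) =
      (\<Sum>\<rho> | \<rho> permutes S. \<Sum>xs\<in>permutations_of_set N. g (map \<rho> (?F xs)))"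
    by (rule sum.cong[OF refl]) simp
  also have "\<dots> = (\<Sum>xs\<in>permutations_of_set N. \<Sum>\<rho> | \<rho> permutes S. g (map \<rho> (?F xs)))"
    by (rule sum.swap)
  also have "\<dots> = (\<Sum>xs\<in>permutations_of_set N. \<Sum>ys\<in>permutations_of_set S. g ys)"
  proof (rule sum.cong)
    fix xs assume "xs \<in> permutations_of_set N"
    then have xs: "set (?F xs) = S" "distinct (?F xs)"
      using assms(2) by (auto dest: permutations_of_setD)
    show "(\<Sum>\<rho> | \<rho> permutes S. g (map \<rho> (?F xs))) = (\<Sum>ys\<in>permutations_of_set S. g ys)"
      using bij_betw_map_permutes_permutations_of_set[OF xs(2)] unfolding xs(1)
      by (rule sum.reindex_bij_betw)
  qed simp
  finally show ?thesis .
qed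

context unital_algebra
begin

lemma ordered_det_cong:
  assumes "\<And>x y. x \<in> set xs \<Longrightarrow> y \<in> set xs \<Longrightarrow> a x y = b x y"
  shows "ordered_det scale a xs = ordered_det scale b xs"
  unfolding ordered_det_def
  by (intro sum.cong refl arg_cong[where f = "scale _"] arg_cong[where f = prod_list] map_cong)
     (auto intro!: assms simp: permutes_in_image)

text \<open>Relabelling the indices conjugates each permutation by \<open>f\<close>, which keeps its
  sign, and leaves the order of the factors as it was.\<close>

lemma ordered_det_map:
  assumes "inj_on f (set xs)"
  shows "ordered_det scale a (map f xs) = ordered_det scale (\<lambda>x y. a (f x) (f y)) xs"
proof -
  have bij: "bij_betw f (set xs) (set (map f xs))"
    using assms by (simp add: bij_betw_def)
  have "ordered_det scale a (map f xs) = (\<Sum>\<pi> | \<pi> permutes set xs.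
      scale (of_int (sign (map_permutation (set xs) f \<pi>)))
        (prod_list (map (\<lambda>x. a x (map_permutation (set xs) f \<pi> x)) (map f xs))))"
    unfolding ordered_det_def
    by (rule sum.reindex_bij_betw[OF bij_betw_map_permutation[OF bij], symmetric])
  also have "\<dots> = ordered_det scale (\<lambda>x y. a (f x) (f y)) xs"
    unfolding ordered_det_def
  proof (rule sum.cong)
    fix \<pi> assume "\<pi> \<in> {\<pi>. \<pi> permutes set xs}"
    moreover have "map_permutation (set xs) f \<pi> (f x) = f (\<pi> x)" if "x \<in> set xs" for x
      using assms that by (rule map_permutation_apply)
    ultimately show "scale (of_int (sign (map_permutation (set xs) f \<pi>)))
        (prod_list (map (\<lambda>x. a x (map_permutation (set xs) f \<pi> x)) (map f xs))) =
      scale (of_int (sign \<pi>)) (prod_list (map (\<lambda>x. a (f x) (f (\<pi> x))) xs))"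
      using assms by (simp add: sign_map_permutation o_def cong: map_cong)
  qed simp
  finally show ?thesis .
qed

lemma ordered_det_add_one:
  assumes "distinct xs"
  shows "ordered_det scale (\<lambda>x y. a x y + (if x = y then 1 else 0)) xs =
    (\<Sum>S\<in>Pow (set xs). ordered_det scale a (filter (\<lambda>x. x \<in> S) xs))"
proof -
  let ?F = "\<lambda>S. filter (\<lambda>x. x \<in> S) xs"
  let ?t = "\<lambda>\<pi> S. scale (of_int (sign \<pi>)) (prod_list (map (\<lambda>x. a x (\<pi> x)) (?F S)))"
  have "ordered_det scale (\<lambda>x y. a x y + (if x = y then 1 else 0)) xs =
      (\<Sum>\<pi> | \<pi> permutes set xs. \<Sum>S\<in>Pow (set xs). if \<forall>x\<in>set xs - S. x = \<pi> x then ?t \<pi> S else 0)"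
    unfolding ordered_det_def
    by (simp add: prod_list_add_indicator[OF assms, where P = "\<lambda>x. x = _ x"] scale_sum_right
        if_distrib[where f = "scale _"] cong: if_cong)
  also have "\<dots> = (\<Sum>S\<in>Pow (set xs). \<Sum>\<pi> | \<pi> permutes set xs.
      if \<forall>x\<in>set xs - S. x = \<pi> x then ?t \<pi> S else 0)"
    by (rule sum.swap)
  also have "\<dots> = (\<Sum>S\<in>Pow (set xs). ordered_det scale a (?F S))"
  proof (rule sum.cong)
    fix S assume "S \<in> Pow (set xs)"
    then have S: "set (?F S) = S" and sub: "S \<subseteq> set xs" by auto
    \<comment> \<open>The surviving permutations fix everything outside \<open>S\<close>. As
      \<open>sign\<close> does not refer to the set being permuted, their terms are exactly those of
      the Leibniz sum over \<open>S\<close>.\<close>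
    have "{\<pi> \<in> {\<pi>. \<pi> permutes set xs}. \<forall>x\<in>set xs - S. x = \<pi> x} = {\<pi>. \<pi> permutes S}"
      using sub by (auto intro: permutes_subset permutes_superset simp: permutes_not_in)
    then show "(\<Sum>\<pi> | \<pi> permutes set xs. if \<forall>x\<in>set xs - S. x = \<pi> x then ?t \<pi> S else 0) =
        ordered_det scale a (?F S)"
      unfolding ordered_det_def S
      by (subst sum.inter_filter[symmetric]) (simp_all add: finite_permutations)
  qed simp
  finally show ?thesis .
qed

lemma sdet_eq_sum_ordered_det:
  "sdet scale M = scale (1 / fact (dim_row M))
     (\<Sum>xs\<in>permutations_of_set {0..<dim_row M}. ordered_det scale (\<lambda>x y. M $$ (x, y)) xs)"
proof -
  define k where "k = dim_row M"
  let ?P = "{\<sigma>. \<sigma> permutes {0..<k}}"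
  let ?t = "\<lambda>\<sigma> \<tau>. scale (of_int (sign \<sigma>) * of_int (sign \<tau>))
    (prod_list (map (\<lambda>i. M $$ (\<sigma> i, \<tau> i)) [0..<k]))"
  have "(\<Sum>\<tau>\<in>?P. ?t \<sigma> \<tau>) = ordered_det scale (\<lambda>x y. M $$ (x, y)) (map \<sigma> [0..<k])"
    if \<sigma>: "\<sigma> permutes {0..<k}" for \<sigma>
  proof -
    have perm: "permutation \<pi>" if "\<pi> permutes {0..<k}" for \<pi>
      using that by (auto simp: permutation_permutes)
    have "(\<Sum>\<tau>\<in>?P. ?t \<sigma> \<tau>) = (\<Sum>\<pi>\<in>?P. ?t \<sigma> (\<pi> \<circ> \<sigma>))"
      by (rule sum_permutations_compose_right[OF \<sigma>])
    also have "\<dots> = (\<Sum>\<pi>\<in>?P. scale (of_int (sign \<pi>))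
        (prod_list (map (\<lambda>x. M $$ (x, \<pi> x)) (map \<sigma> [0..<k]))))"
    proof (rule sum.cong)
      fix \<pi> assume "\<pi> \<in> ?P"
      \<comment> \<open>The sign of \<sigma> occurs twice and cancels, so \<sigma> influences only
        the order of the factors.\<close>
      then have "sign \<sigma> * sign (\<pi> \<circ> \<sigma>) = sign \<pi>"
        using perm \<sigma> by (simp add: sign_compose mult.commute)
      then have "of_int (sign \<sigma>) * of_int (sign (\<pi> \<circ> \<sigma>)) = (of_int (sign \<pi>) :: 'k)"
        by (simp flip: of_int_mult)
      then show "?t \<sigma> (\<pi> \<circ> \<sigma>) = scale (of_int (sign \<pi>))
          (prod_list (map (\<lambda>x. M $$ (x, \<pi> x)) (map \<sigma> [0..<k])))"
        by (simp add: o_def)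
    qed simp
    also have "\<dots> = ordered_det scale (\<lambda>x y. M $$ (x, y)) (map \<sigma> [0..<k])"
      by (simp add: ordered_det_def permutes_image[OF \<sigma>])
    finally show ?thesis .
  qed
  then have "(\<Sum>(\<sigma>, \<tau>)\<in>?P \<times> ?P. ?t \<sigma> \<tau>) =
      (\<Sum>\<sigma>\<in>?P. ordered_det scale (\<lambda>x y. M $$ (x, y)) (map \<sigma> [0..<k]))"
    by (simp add: sum.cartesian_product[symmetric])
  also have "\<dots> = (\<Sum>xs\<in>permutations_of_set {0..<k}. ordered_det scale (\<lambda>x y. M $$ (x, y)) xs)"
    using bij_betw_map_permutes_permutations_of_set[of "[0..<k]"]
    by (intro sum.reindex_bij_betw) simp
  finally show ?thesis
    by (simp add: sdet_def Let_def k_def)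
qed

text \<open>\<open>submatrix\<close> renumbers rows and columns through \<open>pick S\<close>.
  Transporting the orderings of \<open>{0..<card S}\<close> along this bijection expresses its
  \<open>sdet\<close> by entries of \<open>A\<close> under their original indices.\<close>

lemma sdet_submatrix_eq_sum_ordered_det:
  assumes "A \<in> carrier_mat n n" "S \<subseteq> {0..<n}"
  shows "sdet scale (submatrix A S S) = scale (1 / fact (card S))
     (\<Sum>ys\<in>permutations_of_set S. ordered_det scale (\<lambda>x y. A $$ (x, y)) ys)"
proof -
  let ?a = "\<lambda>x y. A $$ (x, y)" and ?K = "{0..<card S}"
  \<comment> \<open>The dimensions of a submatrix count only the indices of \<open>S\<close> within
    the bounds of \<open>A\<close>; here these are all of \<open>S\<close>.\<close>
  have "{i. i < n \<and> i \<in> S} = S" using assms(2) by auto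
  then have dim: "card {i. i < dim_row A \<and> i \<in> S} = card S" "card {i. i < dim_col A \<and> i \<in> S} = card S"
    using assms(1) by auto
  have pick: "bij_betw (pick S) ?K S"
    using assms(2) by (intro bij_betw_pick) (auto intro: finite_subset)
  then have inj: "inj_on (pick S) ?K" and img: "pick S ` ?K = S"
    by (auto simp: bij_betw_def)
  have "(\<Sum>ys\<in>permutations_of_set S. ordered_det scale ?a ys) =
      (\<Sum>ys\<in>map (pick S) ` permutations_of_set ?K. ordered_det scale ?a ys)"
    by (simp flip: permutations_of_set_image_inj[OF inj] add: img)
  also have "\<dots> = (\<Sum>xs\<in>permutations_of_set ?K. ordered_det scale ?a (map (pick S) xs))"
  proof (subst sum.reindex)
    show "inj_on (map (pick S)) (permutations_of_set ?K)"
      using inj by (intro inj_onI) (metis map_inj_on permutations_of_setD(1) Un_absorb)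
  qed simp
  also have "\<dots> = (\<Sum>xs\<in>permutations_of_set ?K.
      ordered_det scale (\<lambda>x y. submatrix A S S $$ (x, y)) xs)"
  proof (rule sum.cong)
    fix xs assume "xs \<in> permutations_of_set ?K"
    then have xs: "set xs = ?K" by (rule permutations_of_setD)
    then show "ordered_det scale ?a (map (pick S) xs) =
        ordered_det scale (\<lambda>x y. submatrix A S S $$ (x, y)) xs"
      using inj by (auto simp: ordered_det_map submatrix_index dim intro!: ordered_det_cong)
  qed simp
  finally show ?thesis
    by (simp add: sdet_eq_sum_ordered_det dim_submatrix dim)
qed

lemma scale_fact_sum_permutations_of_set_filter:
  assumes "finite N" "S \<subseteq> N"
  shows "scale (1 / fact (card N)) (\<Sum>xs\<in>permutations_of_set N. g (filter (\<lambda>x. x \<in> S) xs)) =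
    scale (1 / fact (card S)) (\<Sum>ys\<in>permutations_of_set S. g ys)" (is "scale _ ?l = scale _ ?r")
proof -
  have S: "finite S" using assms by (rule rev_finite_subset)
  \<comment> \<open>In the double count the outer sum on either side has constant summands, so it
    becomes a factorial. Both factorials are invertible in characteristic 0.\<close>
  have *: "scale (fact (card S)) ?l = scale (fact (card N)) ?r"
    using sum_permutations_of_set_filter[OF assms, of g] assms(1) S
    by (simp add: sum_constant_scale card_permutations[OF refl])
  have "scale (1 / fact (card N)) ?l =
      scale (1 / (fact (card N) * fact (card S))) (scale (fact (card S)) ?l)"
    by simp
  also have "\<dots> = scale (1 / fact (card S)) ?r"
    unfolding * by simp
  finally show ?thesis .
qed

end

theorem theorem3p2:
  fixes scale :: "'k::field_char_0 \<Rightarrow> 'a::{ring, monoid_mult} \<Rightarrow> 'a"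
    and A :: "'a mat" and n :: nat
  assumes "unital_algebra scale"
    and "A \<in> carrier_mat n n"
  shows "sdet scale (A + 1\<^sub>m n) = (\<Sum>S \<in> Pow {0..<n}. sdet scale (submatrix A S S))"
proof -
  interpret unital_algebra scale by fact
  let ?N = "{0..<n}" and ?D = "ordered_det scale (\<lambda>x y. A $$ (x, y))"
  have "ordered_det scale (\<lambda>x y. (A + 1\<^sub>m n) $$ (x, y)) xs =
      (\<Sum>S\<in>Pow ?N. ?D (filter (\<lambda>x. x \<in> S) xs))" if "xs \<in> permutations_of_set ?N" for xs
  proof -
    have xs: "set xs = ?N" "distinct xs" using that by (auto dest: permutations_of_setD)
    have "ordered_det scale (\<lambda>x y. (A + 1\<^sub>m n) $$ (x, y)) xs =
        ordered_det scale (\<lambda>x y. A $$ (x, y) + (if x = y then 1 else 0)) xs"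
      using assms(2) xs(1) by (intro ordered_det_cong) auto
    then show ?thesis by (simp add: ordered_det_add_one[OF xs(2)] xs(1))
  qed
  then have "sdet scale (A + 1\<^sub>m n) = scale (1 / fact n)
      (\<Sum>xs\<in>permutations_of_set ?N. \<Sum>S\<in>Pow ?N. ?D (filter (\<lambda>x. x \<in> S) xs))"
    by (simp add: sdet_eq_sum_ordered_det)
  \<comment> \<open>With \<open>S\<close> outermost, each summand is an average over orderings of
    \<open>?N\<close> that depends only on the induced order of \<open>S\<close>, hence equals the
    average over all orderings of \<open>S\<close>. The case \<open>S = {}\<close> needs no separate
    treatment.\<close>
  also have "\<dots> = (\<Sum>S\<in>Pow ?N. scale (1 / fact n)
      (\<Sum>xs\<in>permutations_of_set ?N. ?D (filter (\<lambda>x. x \<in> S) xs)))"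
    by (subst sum.swap) (rule scale_sum_right)
  also have "\<dots> = (\<Sum>S\<in>Pow ?N. sdet scale (submatrix A S S))"
    using scale_fact_sum_permutations_of_set_filter[of ?N _ ?D]
    by (intro sum.cong) (simp_all add: sdet_submatrix_eq_sum_ordered_det[OF assms(2)])
  finally show ?thesis .
qed

end
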